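(* Let $m\ge 2$. If $n\ge 2$ is even, then $\chi_{lat}(mK_n)=\chi_{lat}(mK_n-e)=n$ for every edge $e$ of $mK_n$. If $n\ge 3$ is odd, then $n\le\chi_{lat}(mK_n)\le m+n-1$.
   Context: Graphs are finite and simple. $mK_n$ is the disjoint union of $m$ copies of the complete graph $K_n$; $G-e$ is $G$ with the edge $e$ deleted (keeping all vertices). For a graph $G$ of order $p$ and size $q$, a local antimagic total labeling of $G$ is a bijection $f:V(G)\cup E(G)\to\{1,\ldots,p+q\}$ such that $w_f(u)\neq w_f(v)$ for every edge $uv$ of $G$, where $w_f(u)=f(u)+\sum_{ux\in E(G)}f(ux)$. $\chi_{lat}(G)$ is the minimum number of distinct values of $w_f$ over all local antimagic total labelings $f$ of $G$. *)

theory Defs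
  imports Main
begin

type_synonym 'a graph = "'a set \<times> 'a set set"

abbreviation verts :: "'a graph \<Rightarrow> 'a set" where "verts G \<equiv> fst G"
abbreviation edges :: "'a graph \<Rightarrow> 'a set set" where "edges G \<equiv> snd G"

definition finite_simple_graph :: "'a graph \<Rightarrow> bool" where
  "finite_simple_graph G \<longleftrightarrow>
     finite (verts G) \<and> (\<forall>e\<in>edges G. e \<subseteq> verts G \<and> card e = 2)"

definition complete_graph :: "nat \<Rightarrow> nat graph" where
  "complete_graph n = ({..<n}, {{a, b} | a b. a < n \<and> b < n \<and> a \<noteq> b})"

definition copies :: "nat \<Rightarrow> 'a graph \<Rightarrow> (nat \<times> 'a) graph" where
  "copies m G = ({..<m} \<times> verts G, {Pair i ` e | i e. i < m \<and> e \<in> edges G})"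

definition delete_edge :: "'a graph \<Rightarrow> 'a set \<Rightarrow> 'a graph" where
  "delete_edge G e = (verts G, edges G - {e})"

text \<open>A total labeling is a function on the disjoint sum of vertices (\<open>Inl\<close>) and edges (\<open>Inr\<close>).\<close>

definition weight :: "'a graph \<Rightarrow> ('a + 'a set \<Rightarrow> nat) \<Rightarrow> 'a \<Rightarrow> nat" where
  "weight G f u = f (Inl u) + (\<Sum>x | {u, x} \<in> edges G. f (Inr {u, x}))"

definition local_antimagic_total_labeling :: "'a graph \<Rightarrow> ('a + 'a set \<Rightarrow> nat) \<Rightarrow> bool" where
  "local_antimagic_total_labeling G f \<longleftrightarrow>
     bij_betw f (verts G <+> edges G) {1..card (verts G) + card (edges G)} \<and>
     (\<forall>u v. {u, v} \<in> edges G \<longrightarrow> weight G f u \<noteq> weight G f v)"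

text \<open>On \<open>nat\<close>, the infimum of a nonempty set is its minimum, and \<open>Inf {} = 0\<close>. Hence a
  positive value or lower bound for \<open>chi_lat G\<close> entails that a labeling exists.\<close>

definition chi_lat :: "'a graph \<Rightarrow> nat" where
  "chi_lat G = Inf {card (weight G f ` verts G) | f. local_antimagic_total_labeling G f}"

lemma finite_simple_graph_complete_graph: "finite_simple_graph (complete_graph n)"
  by (auto simp: finite_simple_graph_def complete_graph_def)

lemma finite_simple_graph_copies:
  assumes "finite_simple_graph G"
  shows "finite_simple_graph (copies m G)"
proof -
  have "card (Pair i ` e) = card e" for i :: nat and e :: "'a set"
    by (simp add: card_image inj_on_def)
  with assms show ?thesis
    by (fastforce simp: finite_simple_graph_def copies_def)
qed

lemma finite_simple_graph_delete_edge:
  "finite_simple_graph G \<Longrightarrow> finite_simple_graph (delete_edge G e)"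
  by (auto simp: finite_simple_graph_def delete_edge_def)

end

theory Submission
  imports Defs "HOL-Combinatorics.Transposition"
begin

text \<open>
A total labeling of a complete graph on \<open>{..<n}\<close> is a symmetric \<open>n \<times> n\<close> array: vertex labels on the
diagonal, edge labels off it, and the weight of vertex \<open>i\<close> is the sum of row \<open>i\<close>. A labeling of \<open>m\<close>
copies is a family of \<open>m\<close> such arrays that uses every number once. If the entries grow from
row to row, then the row sums of each array are strictly increasing, so the labeling is local
antimagic (\<open>label_array.labeling\<close>). The task is to make the row sums depend as little as possible on
the copy \<open>k\<close>. To this end every position of the array receives a block of \<open>m\<close> consecutive numbers,
which the copies traverse upwards (slope \<open>1\<close>) or downwards (slope \<open>-1\<close>). Blocks are ordered along
the columns of the triangle, which makes the arrays grow from row to row whatever the directions are.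

For even \<open>n\<close>, directions alternate like the colours of a checkerboard. Each row then has \<open>n / 2\<close>
blocks of either slope, its sum is the same in all copies, and \<open>n\<close> weights suffice
(\<open>card_checkerboard_weights\<close>).

For odd \<open>n\<close>, slopes \<open>\<plusminus>1\<close> cannot cancel in a row. Instead all edges have slope \<open>-1\<close>, contributing
\<open>-(n - 1)\<close> to each row, and the vertices of \<open>n - 1\<close> of the rows share one block of \<open>m (n - 1)\<close>
numbers, in which they advance by \<open>n - 1\<close> from one copy to the next. These \<open>n - 1\<close> rows have
constant sums; the last row contributes at most \<open>m\<close> further weights
(\<open>card_compensated_weights\<close>).

For the graph without the edge \<open>e\<close>, all edges being equivalent under automorphisms, \<open>e\<close> can be
assumed to carry the label \<open>1\<close> in the checkerboard labeling. Decreasing all labels by \<open>1\<close> turns this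
label into \<open>0\<close>, so that removing \<open>e\<close> changes no weight, and it lowers all weights of a regular graph
by the same amount (\<open>labeling_delete_edge\<close>).

The lower bounds hold because the \<open>n\<close> vertices of an intact copy have distinct weights; for
\<open>m \<ge> 2\<close> a deleted edge leaves some copy intact.
\<close>

abbreviation mK :: "nat \<Rightarrow> nat \<Rightarrow> (nat \<times> nat) graph" where
  "mK m n \<equiv> copies m (complete_graph n)"

section \<open>Labelings of arbitrary graphs\<close>

lemma chi_lat_le:
  assumes "local_antimagic_total_labeling G f" "card (weight G f ` verts G) \<le> c"
  shows "chi_lat G \<le> c"
proof -
  have "chi_lat G \<le> card (weight G f ` verts G)"
    unfolding chi_lat_def by (rule cInf_lower) (use assms(1) in auto)
  with assms(2) show ?thesis by simp
qed

text \<open>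
Since \<open>Inf {} = 0\<close>, one labeling \<open>f\<close> has to be known to exist; the bound itself comes from the
injectivity of every weight function on the clique \<open>Q\<close>.
\<close>

lemma clique_le_chi_lat:
  assumes "local_antimagic_total_labeling G f"
    and "finite (verts G)" "Q \<subseteq> verts G"
    and clique: "\<And>u v. u \<in> Q \<Longrightarrow> v \<in> Q \<Longrightarrow> u \<noteq> v \<Longrightarrow> {u, v} \<in> edges G"
  shows "card Q \<le> chi_lat G"
  unfolding chi_lat_def
proof (rule cInf_greatest)
  show "{card (weight G f ` verts G) |f. local_antimagic_total_labeling G f} \<noteq> {}"
    using assms(1) by blast
next
  fix c assume "c \<in> {card (weight G f ` verts G) |f. local_antimagic_total_labeling G f}"
  then obtain h where h: "local_antimagic_total_labeling G h" and c: "c = card (weight G h ` verts G)"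
    by blast
  have "inj_on (weight G h) Q"
    using h clique unfolding local_antimagic_total_labeling_def inj_on_def by blast
  then have "card Q = card (weight G h ` Q)"
    by (simp add: card_image)
  also have "\<dots> \<le> c"
    unfolding c using assms(2,3) by (intro card_mono) auto
  finally show "card Q \<le> c" .
qed

text \<open>
Labelings can be transported along graph isomorphisms. Applied to automorphisms, this moves a chosen
label to any other edge of the same orbit.
\<close>

lemma labeling_pullback:
  fixes G :: "'a graph" and H :: "'b graph"
  assumes f: "local_antimagic_total_labeling H f"
    and V: "bij_betw \<phi> (verts G) (verts H)"
    and E: "edges H = image \<phi> ` edges G"
    and sub: "edges G \<subseteq> Pow (verts G)"
  defines "h \<equiv> f \<circ> map_sum \<phi> (image \<phi>)"
  shows "local_antimagic_total_labeling G h"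
    and "weight G h ` verts G = weight H f ` verts H"
proof -
  have inj: "inj_on \<phi> (verts G)" and img: "\<phi> ` verts G = verts H"
    using V by (auto simp: bij_betw_def)
  have Ebij: "bij_betw (image \<phi>) (edges G) (edges H)"
    unfolding bij_betw_def E
    using inj_on_image_Pow[OF inj] sub inj_on_subset by blast
  have adj: "{u, v} \<in> edges G \<longleftrightarrow> {\<phi> u, \<phi> v} \<in> edges H" if "u \<in> verts G" "v \<in> verts G" for u v
  proof
    assume "{u, v} \<in> edges G"
    then have "\<phi> ` {u, v} \<in> edges H" unfolding E by (rule imageI)
    then show "{\<phi> u, \<phi> v} \<in> edges H" by simp
  next
    assume "{\<phi> u, \<phi> v} \<in> edges H"
    then obtain e where e: "e \<in> edges G" "\<phi> ` {u, v} = \<phi> ` e" unfolding E by auto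
    have "{u, v} = e"
      using inj_on_image_eq_iff[OF inj, of "{u, v}" e] that e sub by auto
    with e show "{u, v} \<in> edges G" by simp
  qed
  have w: "weight G h u = weight H f (\<phi> u)" if u: "u \<in> verts G" for u
  proof -
    have subH: "e \<subseteq> verts H" if "e \<in> edges H" for e
      using that sub img unfolding E by blast
    have "bij_betw \<phi> {x. {u, x} \<in> edges G} {y. {\<phi> u, y} \<in> edges H}"
    proof (rule bij_betw_imageI)
      show "inj_on \<phi> {x. {u, x} \<in> edges G}"
        using inj sub by (auto intro: inj_on_subset)
      show "\<phi> ` {x. {u, x} \<in> edges G} = {y. {\<phi> u, y} \<in> edges H}"
      proof (intro equalityI subsetI)
        fix y assume "y \<in> \<phi> ` {x. {u, x} \<in> edges G}"
        then show "y \<in> {y. {\<phi> u, y} \<in> edges H}" using adj u sub by auto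
      next
        fix y assume y: "y \<in> {y. {\<phi> u, y} \<in> edges H}"
        then have "y \<in> verts H" using subH by auto
        then obtain x where "x \<in> verts G" "y = \<phi> x" using img by auto
        with y adj u show "y \<in> \<phi> ` {x. {u, x} \<in> edges G}" by auto
      qed
    qed
    from sum.reindex_bij_betw[OF this, of "\<lambda>y. f (Inr {\<phi> u, y})"]
    show ?thesis by (simp add: weight_def h_def)
  qed
  have card_eq: "card (verts G) + card (edges G) = card (verts H) + card (edges H)"
    using bij_betw_same_card[OF V] bij_betw_same_card[OF Ebij] by simp
  have "bij_betw (map_sum \<phi> (image \<phi>)) (verts G <+> edges G) (verts H <+> edges H)"
  proof (rule bij_betw_imageI)
    have Einj: "inj_on (image \<phi>) (edges G)" using Ebij by (rule bij_betw_imp_inj_on)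
    show "inj_on (map_sum \<phi> (image \<phi>)) (verts G <+> edges G)"
      by (rule inj_onI) (auto dest: inj_onD[OF inj] inj_onD[OF Einj])
    show "map_sum \<phi> (image \<phi>) ` (verts G <+> edges G) = verts H <+> edges H"
      unfolding Plus_def image_Un image_image map_sum.simps E img[symmetric] ..
  qed
  then have "bij_betw h (verts G <+> edges G) {1..card (verts G) + card (edges G)}"
    unfolding h_def card_eq
    by (rule bij_betw_trans) (use f in \<open>simp add: local_antimagic_total_labeling_def\<close>)
  moreover have "weight G h u \<noteq> weight G h v" if "{u, v} \<in> edges G" for u v
  proof -
    have uv: "u \<in> verts G" "v \<in> verts G" using that sub by auto
    with that have "{\<phi> u, \<phi> v} \<in> edges H" using adj by blast
    with f uv show ?thesis by (auto simp: w local_antimagic_total_labeling_def)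
  qed
  ultimately show "local_antimagic_total_labeling G h"
    by (simp add: local_antimagic_total_labeling_def)
  show "weight G h ` verts G = weight H f ` verts H"
    unfolding img[symmetric] image_image using w by (intro image_cong) auto
qed

text \<open>
With labels decreased by \<open>1\<close>, the edge \<open>e\<close> has label \<open>0\<close> and can be dropped from all sums. A weight
consists of \<open>d + 1\<close> labels, so all weights decrease by \<open>d + 1\<close>: equal weights stay equal and distinct
ones stay distinct.
\<close>

lemma labeling_delete_edge:
  assumes G: "finite_simple_graph G"
    and f: "local_antimagic_total_labeling G f"
    and e: "e \<in> edges G" "f (Inr e) = 1"
    and reg: "\<And>u. u \<in> verts G \<Longrightarrow> card {x. {u, x} \<in> edges G} = d"
  defines "h \<equiv> (\<lambda>x. f x - 1)"
  shows "local_antimagic_total_labeling (delete_edge G e) h"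
    and "card (weight (delete_edge G e) h ` verts G) = card (weight G f ` verts G)"
proof -
  let ?D = "delete_edge G e"
  have sub: "edges G \<subseteq> Pow (verts G)" and finV: "finite (verts G)"
    using G by (auto simp: finite_simple_graph_def)
  have finE: "finite (edges G)" using sub finV by (meson finite_Pow_iff finite_subset)
  have bij: "bij_betw f (verts G <+> edges G) {1..card (verts G) + card (edges G)}"
    using f by (simp add: local_antimagic_total_labeling_def)
  have pos: "f x \<ge> 1" if "x \<in> verts G <+> edges G" for x
    using bij_betwE[OF bij] that by auto
  have w: "weight G f u = weight ?D h u + (d + 1)" if u: "u \<in> verts G" for u
  proof -
    have fin: "finite {x. {u, x} \<in> edges G}"
      by (rule finite_subset[OF _ finV]) (use sub in auto)
    have "(\<Sum>x | {u, x} \<in> edges ?D. h (Inr {u, x})) = (\<Sum>x | {u, x} \<in> edges G. h (Inr {u, x}))"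
      using fin e by (intro sum.mono_neutral_left) (auto simp: delete_edge_def h_def)
    moreover have "(\<Sum>x | {u, x} \<in> edges G. f (Inr {u, x}))
        = (\<Sum>x | {u, x} \<in> edges G. h (Inr {u, x}) + 1)"
    proof (rule sum.cong[OF refl])
      fix x assume "x \<in> {x. {u, x} \<in> edges G}"
      then have "Inr {u, x} \<in> verts G <+> edges G" by auto
      from pos[OF this] show "f (Inr {u, x}) = h (Inr {u, x}) + 1" by (simp add: h_def)
    qed
    moreover have "f (Inl u) = h (Inl u) + 1"
      using pos[of "Inl u"] u by (simp add: h_def InlI)
    ultimately show ?thesis
      by (simp add: weight_def sum.distrib[of _ "\<lambda>_. Suc 0"] reg[OF u] sum_Suc)
  qed
  let ?N = "card (verts G) + card (edges G)"
  have "inj_on f (verts G <+> edges G)" "f ` (verts G <+> edges G) = {1..?N}"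
    using bij by (auto simp: bij_betw_def)
  then have "f ` (verts G <+> edges G - {Inr e}) = {1..?N} - {1}"
    using e by (subst inj_on_image_set_diff[of f "verts G <+> edges G"]) auto
  moreover have "verts G <+> edges G - {Inr e} = verts ?D <+> edges ?D"
    by (auto simp: delete_edge_def)
  ultimately have "bij_betw f (verts ?D <+> edges ?D) ({1..?N} - {1})"
    using bij by (metis Diff_subset bij_betw_subset)
  moreover have "bij_betw (\<lambda>x. x - 1) ({1..?N} - {1}) {1..?N - 1}"
    by (rule bij_betw_byWitness[where f' = Suc]) auto
  moreover have "?N - 1 = card (verts ?D) + card (edges ?D)"
    using e finE by (simp add: delete_edge_def)
      (metis One_nat_def Suc_pred add_diff_assoc card_gt_0_iff empty_iff less_eq_Suc_le)
  ultimately have "bij_betw h (verts ?D <+> edges ?D) {1..card (verts ?D) + card (edges ?D)}"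
    unfolding h_def using bij_betw_trans[of f _ _ "\<lambda>x. x - 1"] by (simp add: comp_def)
  moreover have "weight ?D h u \<noteq> weight ?D h v" if uv: "{u, v} \<in> edges ?D" for u v
  proof -
    have "{u, v} \<in> edges G" using uv by (auto simp: delete_edge_def)
    moreover from this have "u \<in> verts G" "v \<in> verts G" using sub by auto
    ultimately show ?thesis
      using f w unfolding local_antimagic_total_labeling_def by metis
  qed
  ultimately show "local_antimagic_total_labeling ?D h"
    by (simp add: local_antimagic_total_labeling_def)
  have "weight G f ` verts G = (\<lambda>c. c + (d + 1)) ` weight ?D h ` verts G"
    unfolding image_image using w by (intro image_cong) auto
  moreover have "card ((\<lambda>c. c + (d + 1)) ` weight ?D h ` verts G) = card (weight ?D h ` verts G)"
    by (rule card_image) (simp add: inj_on_def)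
  ultimately show "card (weight ?D h ` verts G) = card (weight G f ` verts G)"
    by simp
qed

section \<open>Disjoint copies of a complete graph\<close>

lemma verts_mK: "verts (mK m n) = {..<m} \<times> {..<n}"
  by (simp only: copies_def complete_graph_def fst_conv)

lemma edges_mK: "edges (mK m n) = {{(k, i), (k, j)} | k i j. k < m \<and> i < j \<and> j < n}"
proof (intro equalityI subsetI)
  fix e assume "e \<in> edges (mK m n)"
  then obtain k a b where *: "k < m" "a < n" "b < n" "a \<noteq> b" "e = {(k, a), (k, b)}"
    unfolding copies_def complete_graph_def snd_conv by auto
  show "e \<in> {{(k, i), (k, j)} | k i j. k < m \<and> i < j \<and> j < n}"
  proof (cases "a < b")
    case True with * show ?thesis by blast
  next
    case False
    with * have "b < a" "e = {(k, b), (k, a)}" by auto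
    with * show ?thesis by blast
  qed
next
  fix e assume "e \<in> {{(k, i), (k, j)} | k i j. k < m \<and> i < j \<and> j < n}"
  then obtain k a b where *: "k < m" "a < b" "b < n" "e = {(k, a), (k, b)}"
    by blast
  have "{a, b} \<in> edges (complete_graph n)"
    unfolding complete_graph_def snd_conv mem_Collect_eq
    using * by (intro exI[of _ a] exI[of _ b]) simp
  moreover have "e = Pair k ` {a, b}" using * by simp
  ultimately show "e \<in> edges (mK m n)"
    unfolding copies_def snd_conv mem_Collect_eq using * by (intro exI conjI)
qed

lemma adjacent_mK:
  "{(k, i), v} \<in> edges (mK m n) \<longleftrightarrow> k < m \<and> i < n \<and> (\<exists>j<n. j \<noteq> i \<and> v = (k, j))"
  (is "?L \<longleftrightarrow> ?R")
proof
  assume ?L then show ?R by (force simp: edges_mK doubleton_eq_iff)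
next
  assume ?R
  then obtain j where "k < m" "i < n" "j < n" "j \<noteq> i" "v = (k, j)" by blast
  then show ?L
    by (cases "i < j") (force simp: edges_mK insert_commute)+
qed

lemma edges_mK_subset: "edges (mK m n) \<subseteq> Pow (verts (mK m n))"
  by (auto simp: edges_mK verts_mK)

lemma finite_simple_graph_mK: "finite_simple_graph (mK m n)"
  by (intro finite_simple_graph_copies finite_simple_graph_complete_graph)

lemma neighbours_mK:
  assumes "k < m" "i < n"
  shows "{x. {(k, i), x} \<in> edges (mK m n)} = Pair k ` ({..<n} - {i})"
  using assms by (auto simp: adjacent_mK)

lemma card_neighbours_mK:
  "u \<in> verts (mK m n) \<Longrightarrow> card {x. {u, x} \<in> edges (mK m n)} = n - 1"
  by (auto simp: verts_mK neighbours_mK card_image inj_on_def)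

lemma card_edges_mK: "card (edges (mK m n)) = m * (n choose 2)"
proof -
  let ?S = "edges (complete_graph n)"
  have S: "?S = {e. e \<subseteq> {..<n} \<and> card e = 2}"
    by (auto simp: complete_graph_def card_2_iff)
  have "card ?S = n choose 2" unfolding S by (simp add: n_subsets)
  moreover have "edges (mK m n) = (\<lambda>(k, e). Pair k ` e) ` ({..<m} \<times> ?S)"
    unfolding copies_def snd_conv by auto
  \<comment> \<open>Edges are nonempty, so the number of the copy can be read off the edge.\<close>
  moreover have "inj_on (\<lambda>(k :: nat, e). Pair k ` e) ({..<m} \<times> ?S)"
  proof (rule inj_on_inverseI[where g = "\<lambda>x. (Min (fst ` x), snd ` x)"])
    fix z assume "z \<in> {..<m} \<times> ?S"
    then obtain k a b where "z = (k, {a, b})" by (auto simp: complete_graph_def)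
    then show "(Min (fst ` (case z of (k, e) \<Rightarrow> Pair k ` e)),
        snd ` (case z of (k, e) \<Rightarrow> Pair k ` e)) = z" by simp
  qed
  ultimately show ?thesis by (simp add: card_image card_cartesian_product)
qed

section \<open>Labelings from symmetric arrays\<close>

text \<open>
The position of a vertex or an edge is the copy together with a cell on or above the diagonal. The two
ends of an edge are unordered, hence minimum and maximum; an edge stays within one copy, so the
minimum of its first components is just the number of that copy.
\<close>

definition position :: "(nat \<times> nat) + (nat \<times> nat) set \<Rightarrow> nat \<times> nat \<times> nat" where
  "position x = (case x of Inl (k, i) \<Rightarrow> (k, i, i)
     | Inr e \<Rightarrow> (Min (fst ` e), Min (snd ` e), Max (snd ` e)))"

definition array_labeling ::
    "(nat \<Rightarrow> nat \<Rightarrow> nat \<Rightarrow> nat) \<Rightarrow> (nat \<times> nat) + (nat \<times> nat) set \<Rightarrow> nat" where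
  "array_labeling g x = (case position x of (k, i, j) \<Rightarrow> g k i j)"

lemma position_Inr [simp]: "position (Inr {(k, i), (k, j)}) = (k, min i j, max i j)"
  by (simp add: position_def)

lemma position_Inl [simp]: "position (Inl (k, i)) = (k, i, i)"
  by (simp add: position_def)

definition upper_triangle :: "nat \<Rightarrow> nat \<Rightarrow> (nat \<times> nat \<times> nat) set" where
  "upper_triangle m n = {(k, i, j). k < m \<and> i \<le> j \<and> j < n}"

lemma position_in: "x \<in> verts (mK m n) <+> edges (mK m n) \<Longrightarrow> position x \<in> upper_triangle m n"
  by (auto simp: edges_mK verts_mK upper_triangle_def)

lemma inj_on_position: "inj_on position (verts (mK m n) <+> edges (mK m n))"
  by (auto simp: inj_on_def edges_mK verts_mK)

text \<open>
Conditions on a family of symmetric arrays under which it is a local antimagic labeling. Injectivity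
and the range give bijectivity by counting. The last two conditions make the row sums increase: in the
columns \<open>i\<close> and \<open>i'\<close>, the rows \<open>i\<close> and \<open>i'\<close> share the entry at \<open>(i, i')\<close>, which leaves the two
diagonal entries to be compared.
\<close>

locale label_array =
  fixes m n :: nat and g :: "nat \<Rightarrow> nat \<Rightarrow> nat \<Rightarrow> nat"
  assumes sym: "g k i j = g k j i"
    and inj: "inj_on (\<lambda>(k, i, j). g k i j) (upper_triangle m n)"
    and range: "(k, i, j) \<in> upper_triangle m n \<Longrightarrow> g k i j \<in> {1..m * n + m * (n choose 2)}"
    and mono: "\<lbrakk>k < m; i < i'; i' < n; j < n; j \<noteq> i; j \<noteq> i'\<rbrakk> \<Longrightarrow> g k i j \<le> g k i' j"
    and diag: "\<lbrakk>k < m; i < i'; i' < n\<rbrakk> \<Longrightarrow> g k i i < g k i' i'"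
begin

lemma weight_row_sum:
  assumes "k < m" "i < n"
  shows "weight (mK m n) (array_labeling g) (k, i) = (\<Sum>j<n. g k i j)"
proof -
  have "array_labeling g (Inr {(k, i), (k, j)}) = g k i j" for j
    using sym by (simp add: array_labeling_def min_def max_def)
  then have "weight (mK m n) (array_labeling g) (k, i) = g k i i + (\<Sum>j\<in>{..<n} - {i}. g k i j)"
    by (simp add: weight_def neighbours_mK[OF assms] sum.reindex inj_on_def array_labeling_def)
  with assms show ?thesis by (simp add: sum.remove[of _ i])
qed

lemma row_sum_less:
  assumes "k < m" "i < i'" "i' < n"
  shows "(\<Sum>j<n. g k i j) < (\<Sum>j<n. g k i' j)"
proof -
  let ?J = "{..<n} - {i} - {i'}"
  have split: "(\<Sum>j<n. h j) = h i + (h i' + (\<Sum>j\<in>?J. h j))" for h :: "nat \<Rightarrow> nat"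
    using assms by (simp add: sum.remove[of _ i] sum.remove[of _ i'])
  have "(\<Sum>j\<in>?J. g k i j) \<le> (\<Sum>j\<in>?J. g k i' j)"
    using assms by (intro sum_mono mono) auto
  with diag[OF assms] show ?thesis
    unfolding split by (simp add: sym[of k i' i])
qed

lemma labeling: "local_antimagic_total_labeling (mK m n) (array_labeling g)"
proof -
  let ?A = "verts (mK m n) <+> edges (mK m n)"
  let ?N = "card (verts (mK m n)) + card (edges (mK m n))"
  have N: "?N = m * n + m * (n choose 2)" by (simp add: verts_mK card_edges_mK)
  have eq: "array_labeling g = (\<lambda>(k, i, j). g k i j) \<circ> position"
    by (auto simp: array_labeling_def)
  have "inj_on (array_labeling g) ?A"
    unfolding eq
    by (intro comp_inj_on inj_on_position inj_on_subset[OF inj] image_subsetI position_in)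
  moreover have "array_labeling g ` ?A = {1..?N}"
  proof (rule card_subset_eq)
    show "array_labeling g ` ?A \<subseteq> {1..?N}"
      unfolding N
    proof (rule image_subsetI)
      fix x assume "x \<in> ?A"
      moreover obtain k i j where "position x = (k, i, j)" by (cases "position x")
      ultimately show "array_labeling g x \<in> {1..m * n + m * (n choose 2)}"
        using position_in[of x m n] range[of k i j] by (simp add: array_labeling_def)
    qed
    have "finite (verts (mK m n))" "finite (edges (mK m n))"
      using edges_mK_subset[of m n] by (auto simp: verts_mK intro: finite_subset)
    then show "card (array_labeling g ` ?A) = card {1..?N}"
      using calculation by (simp add: card_image card_Plus)
  qed simp
  moreover have "weight (mK m n) (array_labeling g) u \<noteq> weight (mK m n) (array_labeling g) v"
    if "{u, v} \<in> edges (mK m n)" for u v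
  proof -
    obtain k i where u: "u = (k, i)" by (cases u)
    with that obtain j where "v = (k, j)" "k < m" "i < n" "j < n" "j \<noteq> i"
      by (auto simp: adjacent_mK)
    with u show ?thesis
      using row_sum_less[of k i j] row_sum_less[of k j i]
      by (cases "i < j") (auto simp: weight_row_sum)
  qed
  ultimately show ?thesis
    by (simp add: local_antimagic_total_labeling_def bij_betw_def)
qed

end

section \<open>Enumerating the pairs\<close>

text \<open>
The pairs \<open>i < j\<close> are numbered by increasing \<open>j\<close>, then by increasing \<open>i\<close>. The pairs below \<open>n\<close> get
the numbers below \<open>n choose 2\<close>, starting with \<open>0\<close> for the pair \<open>0, 1\<close>.
\<close>

definition pair_index :: "nat \<Rightarrow> nat \<Rightarrow> nat" where
  "pair_index i j = (max i j choose 2) + min i j"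

lemma pair_index_commute: "pair_index i j = pair_index j i"
  by (simp add: pair_index_def max.commute min.commute)

lemma pair_index_less_choose:
  assumes "i \<noteq> j" "i < n" "j < n"
  shows "pair_index i j < n choose 2"
proof -
  have "pair_index i j < Suc (max i j) choose 2"
    using assms(1) by (auto simp: pair_index_def numeral_2_eq_2 min_def max_def)
  also have "\<dots> \<le> n choose 2"
    using assms by (intro binomial_right_mono) auto
  finally show ?thesis .
qed

text \<open>
This strict growth from row to row makes whole blocks of labels increase, so the order within the
blocks can be chosen freely.
\<close>

lemma pair_index_mono:
  assumes "i < i'" "j \<noteq> i" "j \<noteq> i'"
  shows "pair_index i j < pair_index i' j"
proof (cases "j < i'")
  case True
  then have "pair_index i j < i' choose 2" using assms by (intro pair_index_less_choose) auto
  then show ?thesis using True by (simp add: pair_index_def max_def)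
next
  case False
  then show ?thesis using assms by (simp add: pair_index_def min_def max_def)
qed

lemma pair_index_inj:
  assumes "i < j" "i' < j'" "pair_index i j = pair_index i' j'"
  shows "i = i' \<and> j = j'"
proof -
  have "j = j'"
  proof (rule ccontr)
    assume "j \<noteq> j'"
    then consider "j < j'" | "j' < j" by linarith
    then show False
    proof cases
      case 1
      then have "pair_index i j < j' choose 2" using assms by (intro pair_index_less_choose) auto
      then show False using assms by (simp add: pair_index_def max_def)
    next
      case 2
      then have "pair_index i' j' < j choose 2" using assms by (intro pair_index_less_choose) auto
      then show False using assms by (simp add: pair_index_def max_def)
    qed
  qed
  with assms show ?thesis by (simp add: pair_index_def)
qed

lemma block_less:
  fixes m p q r s :: nat
  assumes "p < q" "r \<le> m" "1 \<le> s"
  shows "m * p + r < m * q + s"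
proof -
  have "m * Suc p \<le> m * q" using assms(1) by (intro mult_le_mono2) simp
  with assms(2,3) show ?thesis by simp
qed

lemma block_inj:
  fixes m p q r s :: nat
  assumes "m * p + r = m * q + s" "r \<in> {1..m}" "s \<in> {1..m}"
  shows "p = q \<and> r = s"
proof -
  have "p = q"
    using block_less[of p q r m s] block_less[of q p s m r] assms
    by (cases p q rule: linorder_cases) auto
  with assms show ?thesis by simp
qed

section \<open>Constant row sums for even order\<close>

text \<open>
The diagonal cells come after all others, so that an edge gets the first block and with it the
label \<open>1\<close>, as the deletion of an edge requires.
\<close>

definition cell_index :: "nat \<Rightarrow> nat \<Rightarrow> nat \<Rightarrow> nat" where
  "cell_index n i j = (if i = j then (n choose 2) + i else pair_index i j)"

lemma cell_index_inj:
  assumes "cell_index n i j = cell_index n i' j'" "i \<le> j" "j < n" "i' \<le> j'" "j' < n"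
  shows "i = i' \<and> j = j'"
  using assms pair_index_less_choose[of i j n] pair_index_less_choose[of i' j' n]
    pair_index_inj[of i j i' j']
  by (auto simp: cell_index_def split: if_splits)

text \<open>
Cells with even \<open>i + j\<close> traverse their block downwards, the others upwards. This choice gives the
edge \<open>{(0, 0), (0, 1)}\<close> the label \<open>1\<close>.
\<close>

definition checkerboard_array :: "nat \<Rightarrow> nat \<Rightarrow> nat \<Rightarrow> nat \<Rightarrow> nat \<Rightarrow> nat" where
  "checkerboard_array m n k i j = m * cell_index n i j + (if even (i + j) then m - k else k + 1)"

lemma label_array_checkerboard: "label_array m n (checkerboard_array m n)"
proof
  fix k i j
  show "checkerboard_array m n k i j = checkerboard_array m n k j i"
    by (simp add: checkerboard_array_def cell_index_def pair_index_commute add.commute)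
next
  show "inj_on (\<lambda>(k, i, j). checkerboard_array m n k i j) (upper_triangle m n)"
  proof (rule inj_onI, clarsimp simp: upper_triangle_def)
    fix k i j k' i' j'
    assume eq: "checkerboard_array m n k i j = checkerboard_array m n k' i' j'"
      and *: "k < m" "k' < m" "i \<le> j" "j < n" "i' \<le> j'" "j' < n"
    let ?r = "\<lambda>k i j :: nat. if even (i + j) then m - k else k + 1"
    have "cell_index n i j = cell_index n i' j' \<and> ?r k i j = ?r k' i' j'"
      by (rule block_inj[of m]) (use eq * in \<open>auto simp: checkerboard_array_def\<close>)
    moreover from this have "i = i' \<and> j = j'" using * cell_index_inj by blast
    ultimately show "k = k' \<and> i = i' \<and> j = j'" using * by (auto split: if_splits)
  qed
next
  fix k i j assume "(k, i, j) \<in> upper_triangle m n"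
  then have *: "k < m" "i \<le> j" "j < n" by (auto simp: upper_triangle_def)
  have "cell_index n i j < n + (n choose 2)"
    using * pair_index_less_choose[of i j n] by (auto simp: cell_index_def)
  then have "m * Suc (cell_index n i j) \<le> m * (n + (n choose 2))"
    by (intro mult_le_mono2) simp
  then show "checkerboard_array m n k i j \<in> {1..m * n + m * (n choose 2)}"
    using * by (auto simp: checkerboard_array_def algebra_simps)
next
  fix k i i' j assume *: "k < m" "i < i'" "i' < n" "j < n" "j \<noteq> i" "j \<noteq> i'"
  then have "cell_index n i j < cell_index n i' j"
    using pair_index_mono[of i i' j] by (auto simp: cell_index_def)
  then show "checkerboard_array m n k i j \<le> checkerboard_array m n k i' j"
    unfolding checkerboard_array_def by (rule less_imp_le[OF block_less]) (use * in auto)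
next
  fix k i i' assume "k < m" "i < i'" "i' < n"
  then show "checkerboard_array m n k i i < checkerboard_array m n k i' i'"
    unfolding checkerboard_array_def by (intro block_less) (auto simp: cell_index_def)
qed

lemma checkerboard_array_row_sum:
  assumes "even n" "k < m"
  shows "(\<Sum>j<n. checkerboard_array m n k i j) = m * (\<Sum>j<n. cell_index n i j) + (n div 2) * (m + 1)"
proof -
  obtain h where h: "n = 2 * h" using assms(1) by blast
  have "(\<Sum>j<2 * h. if even (i + j) then m - k else k + 1) = h * (m + 1)"
    using assms(2) by (induction h) auto
  then show ?thesis
    by (simp add: checkerboard_array_def sum.distrib sum_distrib_left h)
qed

lemma card_checkerboard_weights:
  assumes "even n"
  shows "card (weight (mK m n) (array_labeling (checkerboard_array m n)) ` verts (mK m n)) \<le> n"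
proof -
  interpret label_array m n "checkerboard_array m n" by (rule label_array_checkerboard)
  define c where "c i = m * (\<Sum>j<n. cell_index n i j) + (n div 2) * (m + 1)" for i
  have "weight (mK m n) (array_labeling (checkerboard_array m n)) ` verts (mK m n) \<subseteq> c ` {..<n}"
    using assms by (auto simp: verts_mK weight_row_sum checkerboard_array_row_sum c_def)
  then have "card (weight (mK m n) (array_labeling (checkerboard_array m n)) ` verts (mK m n))
      \<le> card (c ` {..<n})"
    by (intro card_mono) auto
  also have "\<dots> \<le> n" using card_image_le[of "{..<n}" c] by simp
  finally show ?thesis .
qed

text \<open>
Copies and vertices can be permuted independently: one transposition moves the copy of \<open>e\<close> to \<open>0\<close>,
and two transpositions move its ends to \<open>0\<close> and \<open>1\<close>.
\<close>

lemma mK_edge_transitive: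
  assumes "e \<in> edges (mK m n)"
  obtains \<phi> where "bij_betw \<phi> (verts (mK m n)) (verts (mK m n))"
    and "edges (mK m n) = image \<phi> ` edges (mK m n)"
    and "\<phi> ` e = {(0, 0), (0, 1)}"
proof -
  obtain k a b where e: "e = {(k, a), (k, b)}" "k < m" "a < b" "b < n"
    using assms by (auto simp: edges_mK)
  define \<tau> where "\<tau> = transpose k (0::nat)"
  \<comment> \<open>The first transposition may move \<open>b\<close>; the second one has to act on where \<open>b\<close> then is.\<close>
  define b' where "b' = transpose a 0 b"
  define \<sigma> where "\<sigma> = transpose b' (1::nat) \<circ> transpose a 0"
  define \<phi> where "\<phi> = map_prod \<tau> \<sigma>"
  have b': "b' \<noteq> 0" "b' < n" using e by (auto simp: b'_def transpose_def)
  have \<sigma>: "bij \<sigma>" "bij \<tau>" by (auto simp: \<sigma>_def \<tau>_def intro: bij_comp)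
  have \<sigma>ab: "\<sigma> a = 0" "\<sigma> b = 1" using b' by (auto simp: \<sigma>_def b'_def[symmetric])
  have lt\<sigma>: "\<sigma> i < n \<longleftrightarrow> i < n" for i using e b' by (auto simp: \<sigma>_def transpose_def)
  have lt\<tau>: "\<tau> i < m \<longleftrightarrow> i < m" for i using e by (auto simp: \<tau>_def transpose_def)
  have bij: "bij \<phi>" unfolding \<phi>_def using \<sigma>
    by (metis bij_def map_prod_surj prod.inj_map)
  have adj: "{u, v} \<in> edges (mK m n) \<longleftrightarrow> {\<phi> u, \<phi> v} \<in> edges (mK m n)" for u v
    using \<sigma> by (cases u; cases v)
      (auto simp: adjacent_mK \<phi>_def lt\<sigma> lt\<tau> bij_def inj_eq)
  show thesis
  proof
    have "(\<phi> x \<in> verts (mK m n)) = (x \<in> verts (mK m n))" for x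
      by (cases x) (simp add: verts_mK \<phi>_def lt\<sigma> lt\<tau>)
    then have "\<phi> -` verts (mK m n) = verts (mK m n)"
      by (intro set_eqI) (simp only: vimage_eq)
    then have "\<phi> ` verts (mK m n) = verts (mK m n)"
      using surj_image_vimage_eq[OF bij_is_surj[OF bij], of "verts (mK m n)"] by simp
    then show "bij_betw \<phi> (verts (mK m n)) (verts (mK m n))"
      by (rule bij_betw_subset[OF bij subset_UNIV])
    show "edges (mK m n) = image \<phi> ` edges (mK m n)"
    proof (intro equalityI subsetI)
      fix e assume e: "e \<in> edges (mK m n)"
      then obtain u v where uv: "e = {u, v}" by (auto simp: edges_mK)
      obtain u' v' where *: "u = \<phi> u'" "v = \<phi> v'" using bij by (metis bij_pointE)
      then have "{u', v'} \<in> edges (mK m n)" using adj e uv by simp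
      moreover have "e = \<phi> ` {u', v'}" using * uv by simp
      ultimately show "e \<in> image \<phi> ` edges (mK m n)" by blast
    next
      fix e assume "e \<in> image \<phi> ` edges (mK m n)"
      then obtain u v where "e = \<phi> ` {u, v}" "{u, v} \<in> edges (mK m n)"
        by (auto simp: edges_mK) blast
      then show "e \<in> edges (mK m n)" using adj by auto
    qed
    show "\<phi> ` e = {(0, 0), (0, 1)}" by (simp add: e \<phi>_def \<sigma>ab, simp add: \<tau>_def)
  qed
qed

lemma checkerboard_minus_edge:
  assumes "even n" and e: "e \<in> edges (mK m n)"
  obtains h where "local_antimagic_total_labeling (delete_edge (mK m n) e) h"
    and "card (weight (delete_edge (mK m n) e) h ` verts (delete_edge (mK m n) e)) \<le> n"
proof -
  let ?G = "mK m n" and ?f = "array_labeling (checkerboard_array m n)"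
  interpret label_array m n "checkerboard_array m n" by (rule label_array_checkerboard)
  obtain \<phi> where \<phi>: "bij_betw \<phi> (verts ?G) (verts ?G)" "edges ?G = image \<phi> ` edges ?G"
      "\<phi> ` e = {(0, 0), (0, 1)}"
    using mK_edge_transitive[OF e] .
  define f where "f = ?f \<circ> map_sum \<phi> (image \<phi>)"
  have f: "local_antimagic_total_labeling ?G f" "weight ?G f ` verts ?G = weight ?G ?f ` verts ?G"
    unfolding f_def by (rule labeling_pullback[OF labeling \<phi>(1,2) edges_mK_subset])+
  have "f (Inr e) = 1"
    by (simp add: f_def \<phi>(3) array_labeling_def checkerboard_array_def cell_index_def pair_index_def
        numeral_2_eq_2)
  note del = labeling_delete_edge[OF finite_simple_graph_mK f(1) e this card_neighbours_mK]
  show thesis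
    by (rule that[OF del(1)])
      (use del(2) f(2) card_checkerboard_weights[OF assms(1), of m] in \<open>simp_all add: delete_edge_def\<close>)
qed

section \<open>Constant row sums in all rows but one\<close>

text \<open>
The labels up to \<open>m * (n choose 2)\<close> go to the edges, whose blocks are all traversed downwards. The
next \<open>m * (n - 1)\<close> labels go to the vertices \<open>i < n - 1\<close>, copy after copy, so that each of these
vertices advances by \<open>n - 1\<close> from one copy to the next. The largest \<open>m\<close> labels are left for the
vertices \<open>n - 1\<close>.
\<close>

definition compensated_array :: "nat \<Rightarrow> nat \<Rightarrow> nat \<Rightarrow> nat \<Rightarrow> nat \<Rightarrow> nat" where
  "compensated_array m n k i j =
     (if i \<noteq> j then m * pair_index i j + (m - k)
      else m * (n choose 2) + (if i < n - 1 then (n - 1) * k + (i + 1) else m * (n - 1) + (k + 1)))"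

lemma compensated_array_bounds:
  assumes "k < m" "i < n" "j < n"
  shows "i \<noteq> j \<Longrightarrow> compensated_array m n k i j \<in> {1..m * (n choose 2)}"
    and "i < n - 1 \<Longrightarrow> compensated_array m n k i i \<in> {m * (n choose 2)<..m * (n choose 2) + m * (n - 1)}"
    and "\<not> i < n - 1 \<Longrightarrow> compensated_array m n k i i \<in>
           {m * (n choose 2) + m * (n - 1)<..m * n + m * (n choose 2)}"
proof -
  show "compensated_array m n k i j \<in> {1..m * (n choose 2)}" if "i \<noteq> j"
  proof -
    have "m * Suc (pair_index i j) \<le> m * (n choose 2)"
      using pair_index_less_choose[of i j n] assms that by (intro mult_le_mono2) simp
    with assms that show ?thesis by (auto simp: compensated_array_def)
  qed
  show "compensated_array m n k i i \<in> {m * (n choose 2)<..m * (n choose 2) + m * (n - 1)}" if "i < n - 1"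
  proof -
    have "(n - 1) * Suc k \<le> (n - 1) * m"
      using assms by (intro mult_le_mono2) simp
    with that show ?thesis by (auto simp: compensated_array_def mult.commute)
  qed
  show "compensated_array m n k i i \<in> {m * (n choose 2) + m * (n - 1)<..m * n + m * (n choose 2)}"
    if "\<not> i < n - 1"
    using assms that by (cases n) (auto simp: compensated_array_def)
qed

lemma label_array_compensated: "label_array m n (compensated_array m n)"
proof
  fix k i j
  show "compensated_array m n k i j = compensated_array m n k j i"
    by (auto simp: compensated_array_def pair_index_commute)
next
  show "inj_on (\<lambda>(k, i, j). compensated_array m n k i j) (upper_triangle m n)"
  proof (rule inj_onI, clarsimp simp: upper_triangle_def)
    fix k i j k' i' j'
    assume eq: "compensated_array m n k i j = compensated_array m n k' i' j'"
      and *: "k < m" "k' < m" "i \<le> j" "j < n" "i' \<le> j'" "j' < n"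
    note b = compensated_array_bounds[of k m i n j] compensated_array_bounds[of k' m i' n j']
    consider "i < j" "i' < j'" | "i = j" "i' = j'" "i < n - 1" "i' < n - 1"
      | "i = j" "i' = j'" "\<not> i < n - 1" "\<not> i' < n - 1"
      using b eq * by (cases "i = j"; cases "i' = j'"; cases "i < n - 1"; cases "i' < n - 1") auto
    then show "k = k' \<and> i = i' \<and> j = j'"
    proof cases
      case 1
      have "pair_index i j = pair_index i' j' \<and> m - k = m - k'"
        by (rule block_inj[of m]) (use eq * 1 in \<open>auto simp: compensated_array_def\<close>)
      with * 1 pair_index_inj[of i j i' j'] show ?thesis by auto
    next
      case 2
      have "k = k' \<and> i + 1 = i' + 1"
        by (rule block_inj[of "n - 1"]) (use eq * 2 in \<open>auto simp: compensated_array_def\<close>)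
      with 2 show ?thesis by auto
    next
      case 3
      moreover from 3 * have "i = i'" by linarith
      ultimately show ?thesis using eq by (simp add: compensated_array_def)
    qed
  qed
next
  fix k i j assume "(k, i, j) \<in> upper_triangle m n"
  then have *: "k < m" "i \<le> j" "j < n" by (auto simp: upper_triangle_def)
  have le: "m * (n - 1) \<le> m * n" by simp
  consider "i \<noteq> j" | "i = j" "i < n - 1" | "i = j" "\<not> i < n - 1" by blast
  then show "compensated_array m n k i j \<in> {1..m * n + m * (n choose 2)}"
  proof cases
    case 1
    with * compensated_array_bounds(1)[of k m i n j] show ?thesis by simp
  next
    case 2
    with * have "compensated_array m n k i j \<in> {m * (n choose 2)<..m * (n choose 2) + m * (n - 1)}"
      using compensated_array_bounds(2)[of k m i n j] by simp
    with le show ?thesis unfolding atLeastAtMost_iff greaterThanAtMost_iff by linarith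
  next
    case 3
    with * compensated_array_bounds(3)[of k m i n j] show ?thesis by simp
  qed
next
  fix k i i' j assume *: "k < m" "i < i'" "i' < n" "j < n" "j \<noteq> i" "j \<noteq> i'"
  have "m * pair_index i j + (m - k) < m * pair_index i' j + (m - k)"
    by (rule block_less) (use * pair_index_mono[of i i' j] in auto)
  with * show "compensated_array m n k i j \<le> compensated_array m n k i' j"
    unfolding compensated_array_def by simp
next
  fix k i i' assume *: "k < m" "i < i'" "i' < n"
  then have i: "i < n - 1" by linarith
  show "compensated_array m n k i i < compensated_array m n k i' i'"
  proof (cases "i' < n - 1")
    case True
    with * i show ?thesis by (simp add: compensated_array_def)
  next
    case False
    with * have "compensated_array m n k i' i' > m * (n choose 2) + m * (n - 1)"
      using compensated_array_bounds(3)[of k m i' n i'] by simp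
    moreover have "compensated_array m n k i i \<le> m * (n choose 2) + m * (n - 1)"
      using compensated_array_bounds(2)[of k m i n i] * i by simp
    ultimately show ?thesis by linarith
  qed
qed

text \<open>
The copy \<open>k\<close> cancels: the vertex label contributes \<open>(n - 1) * k\<close> and
the \<open>n - 1\<close> edge labels contribute \<open>(n - 1) * (m - k)\<close>.
\<close>

lemma compensated_array_row_sum:
  assumes "k < m" "i < n - 1"
  shows "(\<Sum>j<n. compensated_array m n k i j) =
    m * (n choose 2) + (i + 1) + m * (\<Sum>j\<in>{..<n} - {i}. pair_index i j) + (n - 1) * m"
proof -
  have "(\<Sum>j<n. compensated_array m n k i j)
      = compensated_array m n k i i + (\<Sum>j\<in>{..<n} - {i}. compensated_array m n k i j)"
    using assms by (intro sum.remove) auto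
  also have "(\<Sum>j\<in>{..<n} - {i}. compensated_array m n k i j)
      = (\<Sum>j\<in>{..<n} - {i}. m * pair_index i j + (m - k))"
    by (intro sum.cong) (auto simp: compensated_array_def)
  also have "\<dots> = m * (\<Sum>j\<in>{..<n} - {i}. pair_index i j) + (n - 1) * (m - k)"
    using assms unfolding sum.distrib sum_distrib_left[symmetric] by simp
  finally have "(\<Sum>j<n. compensated_array m n k i j) = compensated_array m n k i i
      + (m * (\<Sum>j\<in>{..<n} - {i}. pair_index i j) + (n - 1) * (m - k))" .
  moreover have "compensated_array m n k i i = m * (n choose 2) + (n - 1) * k + (i + 1)"
    using assms by (simp add: compensated_array_def)
  moreover have "(n - 1) * k + (n - 1) * (m - k) = (n - 1) * m"
    using assms by (simp flip: distrib_left)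
  ultimately show ?thesis by linarith
qed

lemma card_compensated_weights:
  assumes "n \<ge> 1"
  shows "card (weight (mK m n) (array_labeling (compensated_array m n)) ` verts (mK m n)) \<le> m + n - 1"
proof -
  let ?w = "weight (mK m n) (array_labeling (compensated_array m n))"
  interpret label_array m n "compensated_array m n" by (rule label_array_compensated)
  define c where "c i = m * (n choose 2) + (i + 1)
      + m * (\<Sum>j\<in>{..<n} - {i}. pair_index i j) + (n - 1) * m" for i
  define l where "l k = (\<Sum>j<n. compensated_array m n k (n - 1) j)" for k
  have "?w (k, i) \<in> c ` {..<n - 1} \<union> l ` {..<m}" if "k < m" "i < n" for k i
  proof (cases "i < n - 1")
    case True
    with that show ?thesis by (simp add: weight_row_sum compensated_array_row_sum c_def)
  next
    case False
    with that have "i = n - 1" by simp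
    with that show ?thesis by (simp add: weight_row_sum l_def)
  qed
  then have "?w ` verts (mK m n) \<subseteq> c ` {..<n - 1} \<union> l ` {..<m}"
    by (auto simp: verts_mK)
  then have "card (?w ` verts (mK m n)) \<le> card (c ` {..<n - 1} \<union> l ` {..<m})"
    by (intro card_mono) auto
  also have "\<dots> \<le> card (c ` {..<n - 1}) + card (l ` {..<m})"
    by (rule card_Un_le)
  also have "\<dots> \<le> (n - 1) + m"
    using card_image_le[of "{..<n - 1}" c] card_image_le[of "{..<m}" l] by simp
  finally show ?thesis using assms by simp
qed

section \<open>The local antimagic total chromatic number\<close>

lemma copy_le_chi_lat:
  assumes "local_antimagic_total_labeling G f" "verts G = verts (mK m n)" "k < m"
    and "\<And>i j. i < n \<Longrightarrow> j < n \<Longrightarrow> i \<noteq> j \<Longrightarrow> {(k, i), (k, j)} \<in> edges G"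
  shows "n \<le> chi_lat G"
proof -
  have "card ({k} \<times> {..<n}) \<le> chi_lat G"
    using assms by (intro clique_le_chi_lat[of G f]) (auto simp: verts_mK)
  then show ?thesis by (simp add: card_cartesian_product)
qed

theorem theorem3p8:
  fixes m n :: nat
  assumes "m \<ge> 2"
  shows "(n \<ge> 2 \<and> even n \<longrightarrow>
            chi_lat (copies m (complete_graph n)) = n \<and>
            (\<forall>e \<in> edges (copies m (complete_graph n)).
               chi_lat (delete_edge (copies m (complete_graph n)) e) = n)) \<and>
         (n \<ge> 3 \<and> odd n \<longrightarrow>
            n \<le> chi_lat (copies m (complete_graph n)) \<and>
            chi_lat (copies m (complete_graph n)) \<le> m + n - 1)"
proof -
  have lower: "n \<le> chi_lat (mK m n)"
    by (rule copy_le_chi_lat[OF label_array.labeling[OF label_array_compensated] refl, of 0])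
      (use assms in \<open>auto simp: adjacent_mK\<close>)
  have "chi_lat (mK m n) \<le> n" if "even n"
    by (rule chi_lat_le[OF label_array.labeling[OF label_array_checkerboard] card_checkerboard_weights[OF that]])
  moreover have "chi_lat (delete_edge (mK m n) e) = n"
    if ev: "even n" and e: "e \<in> edges (mK m n)" for e
  proof -
    obtain h where h: "local_antimagic_total_labeling (delete_edge (mK m n) e) h"
        "card (weight (delete_edge (mK m n) e) h ` verts (delete_edge (mK m n) e)) \<le> n"
      using checkerboard_minus_edge[OF ev e] .
    obtain k a b where ke: "e = {(k, a), (k, b)}" using e by (auto simp: edges_mK)
    \<comment> \<open>A copy that does not contain the deleted edge.\<close>
    define k' :: nat where "k' = (if k = 0 then 1 else 0)"
    have "k' \<noteq> k" "k' < m" using assms by (auto simp: k'_def)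
    then have "n \<le> chi_lat (delete_edge (mK m n) e)"
      by (intro copy_le_chi_lat[OF h(1), of m _ k'])
        (auto simp: delete_edge_def adjacent_mK ke)
    with chi_lat_le[OF h] show ?thesis by simp
  qed
  moreover have "chi_lat (mK m n) \<le> m + n - 1" if "n \<ge> 3"
    by (rule chi_lat_le[OF label_array.labeling[OF label_array_compensated] card_compensated_weights]) (use that in simp)
  ultimately show ?thesis using lower by (auto intro: antisym)
qed

end
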